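(* Let $G$ be a group and let $k$ be the number of non-power subgroups of $G$ (with $k=\infty$ if there are infinitely many). Then: (1) $k=0$ if and only if $G$ is a cyclic group; (2) $0<k<\infty$ if and only if $G$ is a finite non-cyclic group; (3) $k=\infty$ if and only if $G$ is an infinite non-cyclic group.
   Context: For a group $G$ (not necessarily finite or abelian) and a non-negative integer $m$, $G^{m}=\langle g^{m} \mid g\in G\rangle$ denotes the subgroup of $G$ generated by all $m$-th powers of elements of $G$ (so $G^{0}=\{1\}$ and $G^{1}=G$). A subgroup $H$ of $G$ is called a power subgroup of $G$ if there exists a non-negative integer $m$ such that $H=G^{m}$. A subgroup $H$ of $G$ is called a non-power subgroup of $G$ if $H\neq G^{m}$ for all non-negative integers $m$. Non-power subgroups are counted as subgroups (not up to conjugacy or isomorphism). Cyclic groups may be finite (including trivial) or infinite. *)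

theory Defs
  imports "HOL-Algebra.Elementary_Groups" "HOL-Library.Extended_Nat"
begin

definition group_power :: "('a, 'b) monoid_scheme \<Rightarrow> nat \<Rightarrow> 'a set" where
  "group_power G m = generate G {g [^]\<^bsub>G\<^esub> m | g. g \<in> carrier G}"

definition power_subgroup :: "'a set \<Rightarrow> ('a, 'b) monoid_scheme \<Rightarrow> bool" where
  "power_subgroup H G \<longleftrightarrow> subgroup H G \<and> (\<exists>m. H = group_power G m)"

definition non_power_subgroup :: "'a set \<Rightarrow> ('a, 'b) monoid_scheme \<Rightarrow> bool" where
  "non_power_subgroup H G \<longleftrightarrow> subgroup H G \<and> (\<forall>m. H \<noteq> group_power G m)"

(* The value \<infinity> stands for any infinite cardinality; card alone would give 0 there. *)
definition num_non_power_subgroups :: "('a, 'b) monoid_scheme \<Rightarrow> enat" where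
  "num_non_power_subgroups G =
     (if finite {H. non_power_subgroup H G} then enat (card {H. non_power_subgroup H G}) else \<infinity>)"

end

(* Bezout makes the join of the power subgroups G^a and G^b equal to G^gcd(a,b), and if G^m = <w>
   then G^(mk) = <w^k>.

   If all subgroups of a finite G are powers, all cyclic subgroups are normal, so some w has order
   the exponent e of G; writing <w> = G^m, the second fact forces gcd(m,e) = 1, whence G = <w>.

   Now let G be infinite with finitely many non-power subgroups. If G were torsion, some nontrivial
   <x> = G^m would show that G has finite exponent, so there would be only finitely many power
   subgroups, although an infinite torsion group has infinitely many cyclic ones. So there is g of
   infinite order. For large j both <g^j> and <g^(j+1)> are powers, hence so is their join <g>.
   The least n > 0 such that G^n = <w> is infinite cyclic divides every such exponent, because the
   set of these exponents is closed under gcd. Then G^n is contained in <w^n>, so n = 1. *)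
theory Submission
  imports Defs "HOL-Algebra.Multiplicative_Group" "HOL-Computational_Algebra.Primes"
begin

context group
begin

section \<open>Power subgroups of an arbitrary group\<close>

lemma subgroup_group_power: "subgroup (group_power G m) G"
  unfolding group_power_def by (rule generate_is_subgroup) auto

lemma pow_in_group_power: "g \<in> carrier G \<Longrightarrow> g [^] m \<in> group_power G m"
  unfolding group_power_def by (rule generate.incl) auto

lemma group_power_subsetI:
  assumes "subgroup K G" "\<And>g. g \<in> carrier G \<Longrightarrow> g [^] m \<in> K"
  shows "group_power G m \<subseteq> K"
  unfolding group_power_def using assms by (intro generate_subgroup_incl) auto

lemma subgroup_pow_closed: "subgroup H G \<Longrightarrow> h \<in> H \<Longrightarrow> h [^] (n::nat) \<in> H"
  by (metis int_pow_int subgroup_int_pow_closed)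

lemma subgroup_generate_singleton: "x \<in> carrier G \<Longrightarrow> subgroup (generate G {x}) G"
  by (simp add: generate_is_subgroup)

lemma generate_singleton_subset_iff:
  assumes "subgroup H G" "x \<in> carrier G"
  shows "generate G {x} \<subseteq> H \<longleftrightarrow> x \<in> H"
  using assms generate_subgroup_incl[of "{x}" H] generate.incl[of x "{x}" G] by blast

lemma in_generate_singletonE:
  assumes "h \<in> generate G {x}" "x \<in> carrier G"
  obtains i :: int where "h = x [^] i"
  using assms by (auto simp: generate_pow)

lemma int_pow_in_generate: "x \<in> carrier G \<Longrightarrow> x [^] (i::int) \<in> generate G {x}"
  by (auto simp: generate_pow)

lemma self_in_generate: "x \<in> generate G {x}"
  by (simp add: generate.incl)

lemma group_power_0: "group_power G 0 = {\<one>}"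
proof
  show "group_power G 0 \<subseteq> {\<one>}"
    by (rule group_power_subsetI) (auto simp: triv_subgroup)
qed (use subgroup.one_closed[OF subgroup_group_power] in auto)

lemma group_power_1: "group_power G 1 = carrier G"
proof
  show "group_power G 1 \<subseteq> carrier G"
    using subgroup.subset[OF subgroup_group_power] .
  show "carrier G \<subseteq> group_power G 1"
    using pow_in_group_power[of _ 1] by auto
qed

lemma group_power_antimono:
  assumes "a dvd b" shows "group_power G b \<subseteq> group_power G a"
proof (rule group_power_subsetI[OF subgroup_group_power])
  fix g assume "g \<in> carrier G"
  then show "g [^] b \<in> group_power G a"
    using assms by (metis dvd_def mult.commute nat_pow_closed nat_pow_pow pow_in_group_power)
qed

text \<open>Bezout writes g^gcd(a,b) as a product of powers of g^a and g^b. Together with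
  \<open>group_power_antimono\<close> this makes G^gcd(a,b) the smallest subgroup above G^a and
  G^b.\<close>

lemma group_power_gcd_subset:
  assumes "subgroup K G" "group_power G a \<subseteq> K" "group_power G b \<subseteq> K"
  shows "group_power G (gcd a b) \<subseteq> K"
proof (rule group_power_subsetI[OF assms(1)])
  fix g assume g: "g \<in> carrier G"
  obtain u v where uv: "int (gcd a b) = u * int a + v * int b"
    by (metis bezout_int gcd_int_int_eq)
  have "g [^] gcd a b = g [^] (int a * u + int b * v)"
    using uv by (metis int_pow_int mult.commute)
  also have "\<dots> = (g [^] a) [^] u \<otimes> (g [^] b) [^] v"
    using g by (simp add: int_pow_mult int_pow_int flip: int_pow_pow)
  finally have eq: "g [^] gcd a b = (g [^] a) [^] u \<otimes> (g [^] b) [^] v" .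
  have "g [^] a \<in> K" "g [^] b \<in> K"
    using assms g pow_in_group_power by blast+
  then show "g [^] gcd a b \<in> K"
    unfolding eq
    by (intro subgroup.m_closed[OF assms(1)] subgroup_int_pow_closed[OF assms(1)])
qed

lemma conj_nat_pow:
  assumes "g \<in> carrier G" "x \<in> carrier G"
  shows "(g \<otimes> x \<otimes> inv g) [^] (m::nat) = g \<otimes> x [^] m \<otimes> inv g"
proof (induction m)
  case (Suc m)
  have "inv g \<otimes> (g \<otimes> (x \<otimes> inv g)) = x \<otimes> inv g"
    using assms by (simp flip: m_assoc)
  then have "g \<otimes> x [^] m \<otimes> inv g \<otimes> (g \<otimes> x \<otimes> inv g) = g \<otimes> (x [^] m \<otimes> x) \<otimes> inv g"
    using assms by (simp add: m_assoc)
  then show ?case using Suc by simp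
qed (use assms in simp)

text \<open>Conjugation is an automorphism, so it permutes the m-th powers that generate
  G^m.\<close>

lemma group_power_normal: "group_power G m \<lhd> G"
  unfolding group_power_def
proof (rule normal_generateI)
  fix h g assume "h \<in> {g [^] m |g. g \<in> carrier G}" and g: "g \<in> carrier G"
  then obtain x where x: "x \<in> carrier G" "h = x [^] m" by auto
  have "(g \<otimes> x \<otimes> inv g) [^] m = g \<otimes> x [^] m \<otimes> inv g"
    using conj_nat_pow[OF g x(1)] .
  then show "g \<otimes> h \<otimes> inv g \<in> {g [^] m |g. g \<in> carrier G}"
    using g x by (auto intro!: exI[of _ "g \<otimes> x \<otimes> inv g"])
qed auto

lemma int_pow_nat_pow_commute:
  "x \<in> carrier G \<Longrightarrow> (x [^] (i::int)) [^] (k::nat) = (x [^] k) [^] i"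
  by (metis int_pow_int int_pow_pow mult.commute)

text \<open>The inclusion from right to left is the delicate one: \<open>w\<close> is a product of
  m-th powers and their inverses but need not be an m-th power. It works because raising to the k-th
  power is an endomorphism of the cyclic group G^m.\<close>

lemma group_power_mult:
  assumes w: "w \<in> carrier G" and P: "group_power G m = generate G {w}"
  shows "group_power G (m * k) = generate G {w [^] k}"
proof
  have wk: "w [^] k \<in> carrier G" using w by simp
  note sub = subgroup_generate_singleton[OF wk]
  show "group_power G (m * k) \<subseteq> generate G {w [^] k}"
  proof (rule group_power_subsetI[OF sub])
    fix g assume g: "g \<in> carrier G"
    then obtain i :: int where "g [^] m = w [^] i"
      using pow_in_group_power[of g m] P w by (auto elim: in_generate_singletonE)
    then have "g [^] (m * k) = (w [^] k) [^] i"
      using g w by (metis nat_pow_pow int_pow_nat_pow_commute)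
    then show "g [^] (m * k) \<in> generate G {w [^] k}"
      using int_pow_in_generate[OF wk] by simp
  qed
  let ?P = "group_power G (m * k)"
  \<comment> \<open>The \<open>h\<close> in \<open>G^m\<close> with \<open>h^k\<close> in \<open>G^(mk)\<close>: a subgroup, since \<open>G^m\<close> is abelian, containing all
    \<open>m\<close>-th powers, hence \<open>w\<close>.\<close>
  let ?K = "{w [^] i | i :: int. (w [^] k) [^] i \<in> ?P}"
  have K: "subgroup ?K G"
  proof (rule subgroupI)
    show "?K \<subseteq> carrier G" using w by auto
    have "w [^] (0::int) \<in> ?K"
      using subgroup.one_closed[OF subgroup_group_power] w
      by (intro CollectI exI[of _ 0]) auto
    then show "?K \<noteq> {}" by blast
  next
    fix a assume "a \<in> ?K"
    then obtain i :: int where i: "a = w [^] i" "(w [^] k) [^] i \<in> ?P" by auto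
    have "inv a = w [^] (- i)" "(w [^] k) [^] (- i) \<in> ?P"
      using i w wk subgroup.m_inv_closed[OF subgroup_group_power]
      by (auto simp: int_pow_neg)
    then show "inv a \<in> ?K" using w by blast
  next
    fix a b assume "a \<in> ?K" "b \<in> ?K"
    then obtain i j :: int where i: "a = w [^] i" "(w [^] k) [^] i \<in> ?P"
      and j: "b = w [^] j" "(w [^] k) [^] j \<in> ?P" by auto
    have "a \<otimes> b = w [^] (i + j)" "(w [^] k) [^] (i + j) \<in> ?P"
      using i j w wk subgroup.m_closed[OF subgroup_group_power]
      by (auto simp: int_pow_mult)
    then show "a \<otimes> b \<in> ?K" using w by blast
  qed
  have "group_power G m \<subseteq> ?K"
  proof (rule group_power_subsetI[OF K])
    fix g assume g: "g \<in> carrier G"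
    then obtain i :: int where i: "g [^] m = w [^] i"
      using pow_in_group_power[of g m] P w by (auto elim: in_generate_singletonE)
    then have "g [^] (m * k) = (w [^] k) [^] i"
      using g w by (metis nat_pow_pow int_pow_nat_pow_commute)
    then show "g [^] m \<in> ?K"
      using pow_in_group_power[OF g, of "m * k"] i w by auto
  qed
  then have "w \<in> ?K" using P self_in_generate by blast
  \<comment> \<open>When \<open>w\<close> has finite order, \<open>i\<close> need not be 1; still w
    = w^i gives w^k = (w^k)^i.\<close>
  then obtain i :: int where i: "w = w [^] i" "(w [^] k) [^] i \<in> ?P" by auto
  then have "w [^] k \<in> ?P" by (metis int_pow_nat_pow_commute w)
  then show "generate G {w [^] k} \<subseteq> ?P"
    using generate_singleton_subset_iff[OF subgroup_group_power wk] by blast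
qed

section \<open>Cyclic groups\<close>

lemma cyclic_group_iff_generate:
  "cyclic_group G \<longleftrightarrow> (\<exists>x \<in> carrier G. carrier G = generate G {x})"
  unfolding cyclic_group by (rule bex_cong) (auto simp: generate_pow image_def)

text \<open>If \<open>w\<close> generates G and k > 0 is least with w^k in H, division with
  remainder gives H = <w^k> = G^k. If no such k exists, H is trivial and equals G^0.\<close>

lemma cyclic_group_subgroup_is_power:
  assumes "cyclic_group G" and H: "subgroup H G"
  shows "\<exists>m. H = group_power G m"
proof -
  obtain w where w: "w \<in> carrier G" and gen: "carrier G = generate G {w}"
    using assms(1) cyclic_group_iff_generate by blast
  have P: "group_power G k = generate G {w [^] k}" for k
    using group_power_mult[OF w, of 1 k] gen group_power_1 by simp
  let ?Q = "\<lambda>n::nat. n > 0 \<and> w [^] n \<in> H"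
  \<comment> \<open>Elements of H are integer powers of \<open>w\<close>, while the least exponent
    is sought among positive naturals; inverses bridge the two.\<close>
  have abs_in: "w [^] nat \<bar>i\<bar> \<in> H" if "w [^] i \<in> H" for i :: int
  proof (cases "i \<ge> 0")
    case True then show ?thesis using that by (metis abs_of_nonneg int_nat_eq int_pow_int)
  next
    case False
    then have "w [^] nat \<bar>i\<bar> = inv (w [^] i)"
      using w by (metis abs_of_neg int_nat_eq int_pow_int int_pow_neg linorder_not_le neg_0_le_iff_le order_le_less)
    then show ?thesis using that subgroup.m_inv_closed[OF H] by simp
  qed
  show ?thesis
  proof (cases "\<exists>n. ?Q n")
    case False
    then have zero: "n = 0" if "w [^] n \<in> H" for n :: nat
      using that by auto
    have "h = \<one>" if "h \<in> H" for h
    proof -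
      obtain i :: int where i: "h = w [^] i"
        using \<open>h \<in> H\<close> subgroup.mem_carrier[OF H] gen w by (metis in_generate_singletonE)
      have "w [^] i \<in> H" using i that by simp
      then have "nat \<bar>i\<bar> = 0" by (rule zero[OF abs_in])
      then show ?thesis using i by simp
    qed
    then have "H = {\<one>}" using subgroup.one_closed[OF H] by blast
    then show ?thesis using group_power_0 by blast
  next
    case True
    define k where "k = (LEAST n. ?Q n)"
    have k: "k > 0" "w [^] k \<in> H" using LeastI_ex[OF True] unfolding k_def by simp_all
    have least: "k \<le> n" if "?Q n" for n using Least_le[of ?Q, OF that] unfolding k_def .
    have "H \<subseteq> generate G {w [^] k}"
    proof
      fix h assume h: "h \<in> H"
      obtain i :: int where i: "h = w [^] i"
        using h subgroup.mem_carrier[OF H] gen w by (metis in_generate_singletonE)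
      have split: "w [^] i = (w [^] k) [^] (i div int k) \<otimes> w [^] (i mod int k)"
        using w by (metis int_pow_int int_pow_mult int_pow_pow mult_div_mod_eq)
      have wk: "(w [^] k) [^] (i div int k) \<in> H"
        using k(2) subgroup_int_pow_closed[OF H] by blast
      have "w [^] (i mod int k) = inv ((w [^] k) [^] (i div int k)) \<otimes> w [^] i"
        using w split inv_solve_left by auto
      then have "w [^] (i mod int k) \<in> H"
        using wk h i subgroup.m_closed[OF H] subgroup.m_inv_closed[OF H] by simp
      then have "w [^] nat (i mod int k) \<in> H"
        using k(1) abs_in[of "i mod int k"] by simp
      moreover have "nat (i mod int k) < k"
        using k(1) by (simp add: nat_less_iff)
      ultimately have "\<not> nat (i mod int k) > 0"
        using least[of "nat (i mod int k)"] by linarith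
      moreover have "i mod int k \<ge> 0" using k(1) by simp
      ultimately have "i mod int k = 0" by linarith
      then have "h = (w [^] k) [^] (i div int k)"
        using split i w by simp
      then show "h \<in> generate G {w [^] k}"
        using int_pow_in_generate w by simp
    qed
    moreover have "generate G {w [^] k} \<subseteq> H"
      using generate_singleton_subset_iff[OF H, of "w [^] k"] k w by simp
    ultimately show ?thesis using P by blast
  qed
qed

section \<open>Finite groups\<close>

lemma generate_singleton_coprime_ord_Int:
  assumes x: "x \<in> carrier G" and y: "y \<in> carrier G" and cop: "coprime (ord x) (ord y)"
  shows "generate G {x} \<inter> generate G {y} \<subseteq> {\<one>}"
proof
  fix z assume "z \<in> generate G {x} \<inter> generate G {y}"
  then obtain i j :: int where z: "z = x [^] i" "z = y [^] j"
    using x y by (metis IntD1 IntD2 in_generate_singletonE)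
  then have zc: "z \<in> carrier G" using x by simp
  have "z [^] ord x = \<one>" "z [^] ord y = \<one>"
    using z x y by (metis int_pow_nat_pow_commute int_pow_one pow_ord_eq_1)+
  then have "ord z dvd ord x" "ord z dvd ord y" using zc pow_eq_id by blast+
  then have "ord z = 1" using cop by (metis coprime_common_divisor nat_dvd_1_iff_1)
  then show "z \<in> {\<one>}" using ord_eq_1[OF zc] by simp
qed

text \<open>If (xy)^k = 1 then x^k is the inverse of y^k, so it lies in both cyclic subgroups, which
  meet trivially; hence both orders divide k.\<close>

lemma ord_mult_coprime:
  assumes x: "x \<in> carrier G" and y: "y \<in> carrier G" and cop: "coprime (ord x) (ord y)"
    and comm: "x \<otimes> y = y \<otimes> x"
  shows "ord (x \<otimes> y) = ord x * ord y"
proof (rule dvd_antisym)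
  show "ord (x \<otimes> y) dvd ord x * ord y" using ord_mul_divides assms by blast
  let ?k = "ord (x \<otimes> y)"
  have "x [^] ?k \<otimes> y [^] ?k = \<one>"
    using pow_mult_distrib[OF comm x y] x y by (metis m_closed pow_ord_eq_1)
  then have inv: "x [^] ?k = inv (y [^] ?k)" using x y inv_equality[of "x [^] ?k"] by force
  have "x [^] ?k \<in> generate G {x}" 
    using subgroup_pow_closed[OF subgroup_generate_singleton[OF x] self_in_generate] .
  moreover have "x [^] ?k \<in> generate G {y}" unfolding inv
    using subgroup_pow_closed[OF subgroup_generate_singleton[OF y] self_in_generate]
      subgroup.m_inv_closed[OF subgroup_generate_singleton[OF y]] by blast
  ultimately have 1: "x [^] ?k = \<one>" using generate_singleton_coprime_ord_Int[OF x y cop] by blast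
  then have "y [^] ?k = \<one>" using inv y by (metis inv_inv inv_one nat_pow_closed)
  then show "ord x * ord y dvd ?k"
    using 1 x y cop by (simp add: pow_eq_id divides_mult)
qed

text \<open>An element of maximal order works: were some order not to divide it, exchanging the part
  at one prime would produce an element of larger order.\<close>

lemma exists_ord_eq_exponent:
  assumes fin: "finite (carrier G)"
    and norm: "\<And>x. x \<in> carrier G \<Longrightarrow> generate G {x} \<lhd> G"
  obtains w where "w \<in> carrier G" "\<And>g. g \<in> carrier G \<Longrightarrow> g [^] ord w = \<one>"
proof -
  have "Max (ord ` carrier G) \<in> ord ` carrier G" using fin by (intro Max_in) auto
  then obtain w where w: "w \<in> carrier G" and max: "ord w = Max (ord ` carrier G)" by auto
  have le: "ord x \<le> ord w" if "x \<in> carrier G" for x using fin that max by simp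
  have pos: "ord x > 0" if "x \<in> carrier G" for x
    using ord_ge_1[OF fin that] by simp
  have "g [^] ord w = \<one>" if g: "g \<in> carrier G" for g
  proof (rule ccontr)
    assume "g [^] ord w \<noteq> \<one>"
    then have "\<not> ord g dvd ord w" using pow_eq_id g by blast
    then obtain p where p: "prime p" and lt: "multiplicity p (ord w) < multiplicity p (ord g)"
      using pos[OF w] pos[OF g] multiplicity_le_imp_dvd[of "ord g" "ord w"] not_le by auto
    \<comment> \<open>Here b < a. \<open>?x\<close> keeps the part of \<open>w\<close> of order n
      prime to p, \<open>?y\<close> is the part of \<open>g\<close> of order p^a, and their product
      would have order n * p^a > n * p^b = \<open>ord w\<close>.\<close>
    define a b where "a = multiplicity p (ord g)" and "b = multiplicity p (ord w)"
    obtain n where n: "ord w = p ^ b * n" "\<not> p dvd n"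
      using multiplicity_decompose'[of "ord w" p] p pos[OF w] unfolding b_def
      by (metis not_prime_unit neq0_conv)
    obtain r where r: "ord g = p ^ a * r"
      using multiplicity_dvd[of p "ord g"] unfolding a_def by (auto simp: dvd_def)
    have r0: "r > 0" using r pos[OF g] by (cases r) auto
    have p0: "p > 0" using p prime_gt_0_nat by blast
    let ?x = "w [^] (p ^ b)" and ?y = "g [^] r"
    have ox: "ord ?x = n" using ord_pow[OF w, of "p ^ b"] n p0 by simp
    have oy: "ord ?y = p ^ a" using ord_pow[OF g, of r] r r0 by simp
    have c: "?x \<in> carrier G" "?y \<in> carrier G" using w g by auto
    have cop: "coprime (ord ?x) (ord ?y)"
      using ox oy p n(2) by (metis coprime_commute coprime_power_right_iff prime_imp_coprime)
    \<comment> \<open>Elements of two normal subgroups with trivial intersection commute.\<close>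
    have "?x \<otimes> ?y = ?y \<otimes> ?x"
      using normal_imp_commuting[OF norm[OF c(1)] norm[OF c(2)]
          generate_singleton_coprime_ord_Int[OF c cop]] self_in_generate by blast
    then have "ord (?x \<otimes> ?y) = n * p ^ a" using ord_mult_coprime[OF c cop] ox oy by simp
    then have "n * p ^ a \<le> p ^ b * n" using le[of "?x \<otimes> ?y"] c n(1) by simp
    then have "p ^ a \<le> p ^ b" using n pos[OF w] by (simp add: mult.commute)
    then have "a \<le> b" using prime_gt_1_nat[OF p] by (simp add: power_increasing_iff)
    then show False using lt a_def b_def by simp
  qed
  then show ?thesis using that w by blast
qed

lemma finite_all_subgroups_power_imp_cyclic:
  assumes fin: "finite (carrier G)"
    and all: "\<And>H. subgroup H G \<Longrightarrow> \<exists>m. H = group_power G m"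
  shows "cyclic_group G"
proof -
  have norm: "generate G {x} \<lhd> G" if "x \<in> carrier G" for x
    using all[OF subgroup_generate_singleton[OF that]] group_power_normal by metis
  obtain w where w: "w \<in> carrier G" and exp: "\<And>g. g \<in> carrier G \<Longrightarrow> g [^] ord w = \<one>"
    using exists_ord_eq_exponent[OF fin norm] by blast
  obtain m where m: "group_power G m = generate G {w}"
    using all[OF subgroup_generate_singleton[OF w]] by metis
  have sub: "subgroup (generate G {w}) G" using subgroup_generate_singleton[OF w] .
  define d where "d = gcd m (ord w)"
  have pos: "ord w > 0" using ord_ge_1[OF fin w] by simp
  have triv: "group_power G (ord w) \<subseteq> {\<one>}"
    by (rule group_power_subsetI) (auto simp: exp triv_subgroup)
  \<comment> \<open>This product is the lcm of \<open>m\<close> and the exponent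
    \<open>ord w\<close>, so the power subgroup G^(m * (ord w / d)) = <w^(ord w / d)> is trivial,
    which forces d = 1.\<close>
  have "ord w dvd m * (ord w div d)"
    by (metis d_def div_mult_swap dvd_mult_div_cancel dvd_triv_left gcd_dvd1 gcd_dvd2 mult.commute)
  then have "group_power G (m * (ord w div d)) \<subseteq> {\<one>}"
    using triv group_power_antimono by blast
  then have "w [^] (ord w div d) = \<one>"
    using group_power_mult[OF w m] self_in_generate by blast
  then have "ord w dvd ord w div d" using pow_eq_id[OF w] by blast
  then have "d = 1"
    using pos d_def by (metis div_eq_dividend_iff div_greater_zero_iff dvd_imp_le gcd_le2_nat gcd_pos_nat le_antisym div_le_dividend less_numeral_extra(3))
  then have "group_power G 1 \<subseteq> generate G {w}"
    using group_power_gcd_subset[OF sub, of m "ord w"] m triv subgroup.one_closed[OF sub] d_def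
    by force
  then have "carrier G = generate G {w}"
    using group_power_1 subgroup.subset[OF sub] by blast
  then show ?thesis using cyclic_group_iff_generate w by blast
qed

section \<open>Infinite torsion groups (\<open>ord x = 0\<close> encodes infinite order)\<close>

lemma infinite_torsion_imp_infinite_non_power:
  assumes inf: "infinite (carrier G)" and tor: "\<And>x. x \<in> carrier G \<Longrightarrow> ord x \<noteq> 0"
  shows "infinite {H. non_power_subgroup H G}"
proof
  assume fin: "finite {H. non_power_subgroup H G}"
  define C where "C = (\<lambda>x. generate G {x}) ` carrier G"
  define S where "S = C - {H. non_power_subgroup H G}"
  \<comment> \<open>G is the union of its cyclic subgroups, each of them finite, so there must be
    infinitely many.\<close>
  have "infinite C"
  proof
    assume "finite C"
    moreover have "finite H" if "H \<in> C" for H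
    proof -
      obtain x where x: "x \<in> carrier G" "H = generate G {x}" using \<open>H \<in> C\<close> C_def by blast
      then show ?thesis using finite_cyclic_subgroup_order[OF x(1)] tor[OF x(1)]
        by (simp add: carrier_subgroup_generated)
    qed
    ultimately have "finite (\<Union>C)" by blast
    moreover have "carrier G \<subseteq> \<Union>C" unfolding C_def using self_in_generate by blast
    ultimately show False using inf finite_subset by blast
  qed
  then have S: "infinite S" unfolding S_def using fin by (simp add: Diff_infinite_finite)
  have pow: "\<exists>m. H = group_power G m" if "H \<in> S" for H
    using that subgroup_generate_singleton unfolding S_def C_def non_power_subgroup_def by blast
  \<comment> \<open>A nontrivial member of \<open>S\<close> is wanted because the trivial subgroup
    is G^0, and m = 0 would yield no positive exponent.\<close>
  have "\<not> S \<subseteq> {{\<one>}}" using S finite_subset by blast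
  then obtain H where H: "H \<in> S" "H \<noteq> {\<one>}" by blast
  obtain x where x: "x \<in> carrier G" "H = generate G {x}" using H S_def C_def by blast
  obtain m where m: "group_power G m = generate G {x}" using pow[OF H(1)] x by blast
  have "m \<noteq> 0" using m group_power_0 H x by metis
  define e where "e = m * ord x"
  have e: "e > 0" "group_power G e = {\<one>}"
    using \<open>m \<noteq> 0\<close> tor[OF x(1)] group_power_mult[OF x(1) m, of "ord x"] x
    by (auto simp: e_def generate_one)
  \<comment> \<open>As G^e is trivial, G^a = G^gcd(a,e), so exponents up to \<open>e\<close> already
    give every power subgroup.\<close>
  have "S \<subseteq> group_power G ` {..e}"
  proof
    fix K assume "K \<in> S"
    then obtain a where a: "K = group_power G a" using pow by blast
    have "group_power G (gcd a e) = group_power G a"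
    proof
      show "group_power G (gcd a e) \<subseteq> group_power G a"
        using e(2) subgroup.one_closed[OF subgroup_group_power]
        by (intro group_power_gcd_subset subgroup_group_power) auto
    qed (simp add: group_power_antimono)
    then show "K \<in> group_power G ` {..e}" using a e(1) by (metis atMost_iff gcd_le2_nat image_eqI less_numeral_extra(3))
  qed
  then show False using S finite_subset by blast
qed

section \<open>Groups with an element of infinite order\<close>

lemma int_pow_eq_iff_of_ord_0:
  "x \<in> carrier G \<Longrightarrow> ord x = 0 \<Longrightarrow> x [^] (i::int) = x [^] j \<longleftrightarrow> i = j"
  by (auto simp: int_pow_eq)

lemma dvd_of_pow_in_generate_pow:
  assumes x: "x \<in> carrier G" "ord x = 0" and mem: "x [^] (i::nat) \<in> generate G {x [^] (j::nat)}"
  shows "j dvd i"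
proof -
  obtain k :: int where "x [^] i = (x [^] j) [^] k"
    using mem x by (metis in_generate_singletonE nat_pow_closed)
  then have "x [^] int i = x [^] (int j * k)" using x by (metis int_pow_int int_pow_pow)
  then have "int j dvd int i" using int_pow_eq_iff_of_ord_0[OF x] by simp
  then show ?thesis by simp
qed

lemma int_pow_commute:
  assumes "x \<otimes> y = y \<otimes> x" "x \<in> carrier G" "y \<in> carrier G"
  shows "x [^] (i::int) \<otimes> y = y \<otimes> x [^] i"
proof -
  have c: "x [^] n \<otimes> y = y \<otimes> x [^] n" for n :: nat
    using group_commutes_pow assms by blast
  have "inv (x [^] n) \<otimes> y = y \<otimes> inv (x [^] n)" for n :: nat
  proof -
    have "y = x [^] n \<otimes> (y \<otimes> inv (x [^] n))"
      using c[of n] assms(2,3) by (simp flip: m_assoc) (simp add: m_assoc)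
    then show ?thesis
      using assms(2,3) inv_solve_left[of "y \<otimes> inv (x [^] n)" "x [^] n" y] by simp
  qed
  then show ?thesis using c assms(2)
    by (cases i rule: int_cases2) (simp_all add: int_pow_int int_pow_neg_int)
qed

lemma infinite_order_generate_is_power:
  assumes fin: "finite {H. non_power_subgroup H G}"
    and g: "g \<in> carrier G" "ord g = 0"
  obtains a where "a > 0" "group_power G a = generate G {g}"
proof -
  let ?f = "\<lambda>j::nat. generate G {g [^] j}"
  \<comment> \<open>Injectivity turns the finiteness of the set of non-power subgroups into a bound
    \<open>J\<close> on the indices j with <g^j> non-power.\<close>
  have inj: "inj ?f"
  proof (rule injI)
    have *: "j dvd i" if "?f i = ?f j" for i j
      using dvd_of_pow_in_generate_pow[OF g] self_in_generate that by blast
    fix i j assume "?f i = ?f j"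
    then show "i = j" using *[of i j] *[of j i] by (simp add: dvd_antisym)
  qed
  have "finite {j. ?f j \<in> {H. non_power_subgroup H G}}"
    using finite_vimageI[OF fin inj] by (simp add: vimage_def)
  then obtain J where J: "\<And>j. non_power_subgroup (?f j) G \<Longrightarrow> j \<le> J"
    by (metis (mono_tags, lifting) finite_nat_set_iff_bounded_le mem_Collect_eq)
  have pw: "\<exists>m. ?f j = group_power G m" if "j > J" for j
    using J[of j] that subgroup_generate_singleton[of "g [^] j"] g
    unfolding non_power_subgroup_def by auto
  obtain a where a: "?f (Suc J) = group_power G a" using pw by blast
  obtain b where b: "?f (Suc (Suc J)) = group_power G b" using pw[of "Suc (Suc J)"] by auto
  have sub: "subgroup (generate G {g}) G" using subgroup_generate_singleton[OF g(1)] .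
  have fsub: "?f j \<subseteq> generate G {g}" for j
    using g generate_singleton_subset_iff[OF sub, of "g [^] j"]
      subgroup_pow_closed[OF sub self_in_generate] by simp
  have "group_power G (gcd a b) \<subseteq> generate G {g}"
    using group_power_gcd_subset[OF sub] a b fsub by metis
  moreover have "generate G {g} \<subseteq> group_power G (gcd a b)"
  proof -
    let ?P = "group_power G (gcd a b)"
    have "g [^] Suc J \<in> ?P" "g [^] Suc (Suc J) \<in> ?P"
      using a b self_in_generate group_power_antimono[of "gcd a b" a]
        group_power_antimono[of "gcd a b" b] by (metis gcd_dvd1 gcd_dvd2 subsetD)+
    \<comment> \<open>Consecutive exponents are coprime, so the two subgroups together contain
      \<open>g\<close>.\<close>
    moreover have "g = inv (g [^] Suc J) \<otimes> g [^] Suc (Suc J)"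
      using g inv_solve_left by simp
    ultimately have "g \<in> ?P"
      using subgroup.m_closed[OF subgroup_group_power] subgroup.m_inv_closed[OF subgroup_group_power]
      by metis
    then show ?thesis using generate_singleton_subset_iff[OF subgroup_group_power g(1)] by blast
  qed
  ultimately have eq: "group_power G (gcd a b) = generate G {g}" by blast
  have "gcd a b \<noteq> 0"
  proof
    assume "gcd a b = 0"
    then have "g = \<one>" using eq group_power_0 self_in_generate by (metis singletonD)
    then show False using g by simp
  qed
  then show ?thesis using that eq by blast
qed

lemma infinite_order_finite_non_power_imp_cyclic:
  assumes fin: "finite {H. non_power_subgroup H G}"
    and x: "x \<in> carrier G" "ord x = 0"
  shows "cyclic_group G"
proof -
  \<comment> \<open>The pairs of a positive exponent a with G^a infinite cyclic and a generator of
    G^a.\<close>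
  let ?M = "\<lambda>a w. a > 0 \<and> w \<in> carrier G \<and> ord w = 0 \<and> group_power G a = generate G {w}"
  obtain a1 where a1: "?M a1 x" using infinite_order_generate_is_power[OF fin x] x by metis
  define n where "n = (LEAST a. \<exists>w. ?M a w)"
  have "\<exists>w. ?M n w" unfolding n_def by (rule LeastI_ex) (use a1 in blast)
  then obtain w where w: "w \<in> carrier G" "ord w = 0" and n: "n > 0"
    and Pn: "group_power G n = generate G {w}" by blast
  have least: "n \<le> a" if "?M a v" for a v
    unfolding n_def using that by (intro Least_le) blast
  \<comment> \<open>By minimality of \<open>n\<close> it is enough to show that gcd(a,n) is again
    such an exponent.\<close>
  have dvd: "n dvd a" if g: "g \<in> carrier G" "ord g = 0" and a: "a > 0"
    and Pa: "group_power G a = generate G {g}" for a g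
  proof -
    have "g [^] n \<in> generate G {w}" using pow_in_group_power[OF g(1), of n] Pn by blast
    \<comment> \<open>Both sides are G^(na), so w^a is a power of g^n; \<open>l\<close> is the
      exponent.\<close>
    moreover have "generate G {g [^] n} = generate G {w [^] a}"
      using group_power_mult[OF g(1) Pa, of n] group_power_mult[OF w(1) Pn, of a]
      by (simp add: mult.commute)
    ultimately obtain l where l: "w [^] a = (g [^] n) [^] (l::int)"
      using self_in_generate g by (metis in_generate_singletonE nat_pow_closed)
    \<comment> \<open>Normality of <w> gives g w g^-1 = w^e. Since \<open>g\<close> centralizes w^a,
      a power of \<open>g\<close>, comparing exponents gives ea = a, so e = 1 and \<open>g\<close>
      commutes with \<open>w\<close>.\<close>
    have "group_power G n \<lhd> G" by (rule group_power_normal)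
    then have "g \<otimes> w \<otimes> inv g \<in> generate G {w}"
      using Pn g self_in_generate normal.inv_op_closed2 by metis
    then obtain e :: int where e: "g \<otimes> w \<otimes> inv g = w [^] e"
      using w in_generate_singletonE by metis
    have "g \<otimes> w [^] a = w [^] a \<otimes> g"
    proof -
      have "w [^] a = g [^] (int n * l)" using l g by (metis int_pow_int int_pow_pow)
      moreover have "g \<otimes> g [^] i = g [^] i \<otimes> g" for i :: int
        using g by (metis add.commute int_pow_1 int_pow_mult)
      ultimately show ?thesis by simp
    qed
    then have "g \<otimes> w [^] a \<otimes> inv g = w [^] a" using g w by (simp add: m_assoc)
    then have "w [^] (e * int a) = w [^] int a"
      using conj_nat_pow[OF g(1) w(1), of a] e w by (metis int_pow_int int_pow_pow)
    then have "e = 1" using int_pow_eq_iff_of_ord_0[OF w] a by simp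
    then have "g \<otimes> w \<otimes> inv g = w" using e w by simp
    then have comm: "w \<otimes> g = g \<otimes> w" using g w by (metis inv_solve_right' m_closed)
    define d where "d = gcd a n"
    obtain u v where uv: "int d = u * int a + v * int n"
      unfolding d_def by (metis bezout_int gcd_int_int_eq)
    have comm': "w [^] v \<otimes> g [^] (l * u) = g [^] (l * u) \<otimes> w [^] v"
      using int_pow_commute[OF int_pow_commute[OF comm[symmetric] g(1) w(1), symmetric]] g w by simp
    \<comment> \<open>\<open>h\<close> is chosen so that \<open>h^n = w^d\<close>; if \<open><h> = G^c\<close>, comparing the two expressions for \<open>G^(nc)\<close>
      gives \<open>c = d\<close>.\<close>
    define h where "h = w [^] v \<otimes> g [^] (l * u)"
    have h: "h \<in> carrier G" using h_def g w by simp
    have "h [^] n = (w [^] v) [^] n \<otimes> (g [^] (l * u)) [^] n"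
      unfolding h_def using pow_mult_distrib[OF comm'] g w by simp
    also have "(g [^] (l * u)) [^] n = ((g [^] n) [^] l) [^] u"
      using g by (metis int_pow_nat_pow_commute int_pow_pow nat_pow_closed)
    also have "\<dots> = w [^] (int a * u)"
      using l w by (metis int_pow_int int_pow_pow)
    also have "(w [^] v) [^] n = w [^] (v * int n)"
      using w by (metis int_pow_int int_pow_pow)
    also have "w [^] (v * int n) \<otimes> w [^] (int a * u) = w [^] int d"
      using w uv by (metis add.commute int_pow_mult mult.commute)
    finally have hn: "h [^] n = w [^] d" by (simp add: int_pow_int)
    have d0: "d > 0" using n d_def by simp
    \<comment> \<open>A finite order of \<open>h\<close> would make w^d = h^n a torsion
      element.\<close>
    have oh: "ord h = 0"
    proof (rule ccontr)
      assume "ord h \<noteq> 0"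
      have "w [^] (d * ord h) = (h [^] ord h) [^] n"
        using hn h w by (metis mult.commute nat_pow_pow)
      then have "w [^] (d * ord h) = \<one>" using h by simp
      then show False using w d0 \<open>ord h \<noteq> 0\<close> by (simp add: pow_eq_id)
    qed
    obtain c where c: "c > 0" "group_power G c = generate G {h}"
      using infinite_order_generate_is_power[OF fin h oh] .
    have "generate G {w [^] d} = generate G {w [^] c}"
      using group_power_mult[OF h c(2), of n] group_power_mult[OF w(1) Pn, of c] hn
      by (simp add: mult.commute)
    then have "c = d"
      using dvd_of_pow_in_generate_pow[OF w] self_in_generate by (metis dvd_antisym)
    \<comment> \<open>Now d = gcd(a,n) divides \<open>n\<close> and is at least \<open>n\<close>, so
      it equals \<open>n\<close>, which therefore divides \<open>a\<close>.\<close>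
    then have "n \<le> d"
      using least[of d h] c h oh by blast
    then show ?thesis unfolding d_def using n
      by (metis dvd_imp_le gcd_dvd1 gcd_dvd2 le_antisym)
  qed
  have "group_power G n \<subseteq> generate G {w [^] n}"
  proof (rule group_power_subsetI)
    show "subgroup (generate G {w [^] n}) G" using subgroup_generate_singleton w by simp
    fix g assume g: "g \<in> carrier G"
    obtain i :: int where i: "g [^] n = w [^] i"
      using pow_in_group_power[OF g, of n] Pn w by (metis in_generate_singletonE)
    \<comment> \<open>If \<open>g\<close> has infinite order and <g> = G^a, then n divides a and g^n
      lies in G^(na), inside G^(nn) = <w^n>. Otherwise g^n is a torsion element of the torsion-free
      group <w>, hence trivial.\<close>
    show "g [^] n \<in> generate G {w [^] n}"
    proof (cases "ord g = 0")
      case True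
      obtain a where a: "a > 0" "group_power G a = generate G {g}"
        using infinite_order_generate_is_power[OF fin g True] .
      have "generate G {g [^] n} = group_power G (n * a)"
        using group_power_mult[OF g a(2), of n] by (simp add: mult.commute)
      also have "\<dots> \<subseteq> group_power G (n * n)"
        using dvd[OF g True a] by (intro group_power_antimono) simp
      also have "\<dots> = generate G {w [^] n}" using group_power_mult[OF w(1) Pn] .
      finally show ?thesis using self_in_generate by blast
    next
      case False
      have "w [^] (i * int (ord g)) = (g [^] n) [^] ord g"
        using i w by (metis int_pow_int int_pow_pow)
      also have "\<dots> = (g [^] ord g) [^] n" using g by (metis nat_pow_pow mult.commute)
      also have "\<dots> = w [^] (0::int)" using g by simp
      finally have "i * int (ord g) = 0" using int_pow_eq_iff_of_ord_0[OF w] by blast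
      then have "g [^] n = \<one>" using False i by simp
      then show ?thesis using generate.one by simp
    qed
  qed
  then have "w \<in> generate G {w [^] n}" using Pn self_in_generate by blast
  then obtain k :: int where "w = (w [^] n) [^] k"
    using w by (metis in_generate_singletonE nat_pow_closed)
  then have "w [^] (1::int) = w [^] (int n * k)" using w by (metis int_pow_1 int_pow_int int_pow_pow)
  then have "int n * k = 1" using int_pow_eq_iff_of_ord_0[OF w] by metis
  then have "n = 1" by (metis int_ops(2) nat_dvd_1_iff_1 of_nat_dvd_iff dvd_triv_left)
  then show ?thesis using Pn group_power_1 w cyclic_group_iff_generate by metis
qed

end

theorem mainTheorem1:
  fixes G :: "('a, 'b) monoid_scheme" and k :: enat
  assumes "group G"
    and "k = num_non_power_subgroups G"
  shows "(k = 0 \<longleftrightarrow> cyclic_group G) \<and>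
    (0 < k \<and> k < \<infinity> \<longleftrightarrow> finite (carrier G) \<and> \<not> cyclic_group G) \<and>
    (k = \<infinity> \<longleftrightarrow> infinite (carrier G) \<and> \<not> cyclic_group G)"
proof -
  interpret group G by fact
  let ?N = "{H. non_power_subgroup H G}"
  have cyc: "?N = {}" if "cyclic_group G"
    using cyclic_group_subgroup_is_power[OF that] unfolding non_power_subgroup_def by blast
  have fin: "finite ?N" if "finite (carrier G)"
    by (rule finite_subset[of _ "Pow (carrier G)"])
      (use that subgroup.subset in \<open>auto simp: non_power_subgroup_def\<close>)
  have fin_cyc: "cyclic_group G" if "finite (carrier G)" "?N = {}"
    using finite_all_subgroups_power_imp_cyclic[OF that(1)] that(2)
    unfolding non_power_subgroup_def by blast
  \<comment> \<open>Either every element has finite order, which contradicts the finiteness of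
    \<open>?N\<close>, or some element has infinite order and G is cyclic.\<close>
  have inf_cyc: "cyclic_group G" if "infinite (carrier G)" "finite ?N"
    using infinite_torsion_imp_infinite_non_power[OF that(1)]
      infinite_order_finite_non_power_imp_cyclic[OF that(2)] that(2) by blast
  have k: "k = (if finite ?N then enat (card ?N) else \<infinity>)"
    using assms(2) unfolding num_non_power_subgroups_def .
  have k0: "k = 0 \<longleftrightarrow> ?N = {}" unfolding k
    using infinite_imp_nonempty by (auto simp: zero_enat_def simp del: Collect_empty_eq)
  have kinf: "k = \<infinity> \<longleftrightarrow> infinite ?N" unfolding k by auto
  have pos: "0 < k \<longleftrightarrow> k \<noteq> 0" and less: "k < \<infinity> \<longleftrightarrow> k \<noteq> \<infinity>" by (auto simp: zero_less_iff_neq_zero)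
  show ?thesis unfolding pos less k0 kinf
    using cyc fin fin_cyc inf_cyc by (metis finite.emptyI)
qed

end
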